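(* $f(3,3) = 2-\sqrt{2}$.
   Context: For an integer $s\ge 1$ let $\Sigma_s=\{0,1,\ldots,s-1\}$ with its natural total order. An $n$-word over $\Sigma_s$ is a sequence $w=(w_1,\ldots,w_n)\in(\Sigma_s)^n$. A subword is a subsequence $w_{i_1}\cdots w_{i_k}$ with $i_1<\cdots<i_k$ (counted by position sets); it is monotone if it is non-decreasing or non-increasing. Let $m(k,w)$ be the number of monotone $k$-subwords of $w$, $f(s,k,n)=\min_{w\in(\Sigma_s)^n} m(k,w)/\binom{n}{k}$, and $f(s,k)=\lim_{n\to\infty} f(s,k,n)$. *)

theory Defs
  imports Complex_Main
begin

definition words :: "nat \<Rightarrow> nat \<Rightarrow> nat list set" where
  "words s n = {w. length w = n \<and> set w \<subseteq> {..<s}}"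

definition monotone_word :: "nat list \<Rightarrow> bool" where
  "monotone_word u \<longleftrightarrow> sorted_wrt (\<le>) u \<or> sorted_wrt (\<ge>) u"

text \<open>Subwords are counted by position sets: the subword at the positions \<open>I\<close>
  is \<open>nths w I\<close>.\<close>

definition num_monotone :: "nat \<Rightarrow> nat list \<Rightarrow> nat" where
  "num_monotone k w =
     card {I. I \<subseteq> {..<length w} \<and> card I = k \<and> monotone_word (nths w I)}"

text \<open>For \<open>n < k\<close> the quotient is \<open>0 / 0 = 0\<close>; these finitely many values do not
  affect the limit.\<close>

definition min_density :: "nat \<Rightarrow> nat \<Rightarrow> nat \<Rightarrow> real" where
  "min_density s k n =
     Min ((\<lambda>w. real (num_monotone k w) / real (n choose k)) ` words s n)"

text \<open>As \<^const>\<open>lim\<close> is unspecified on divergent sequences, statements about this value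
  should also assert convergence.\<close>

definition limit_density :: "nat \<Rightarrow> nat \<Rightarrow> real" where
  "limit_density s k = lim (min_density s k)"

end

theory Submission imports Defs begin

text \<open>A triple is non-monotone iff its middle letter is a strict local extremum, so the
  non-monotone triples are counted position by position from the letters to the left and to the
  right. Let \<open>b\<close> be the number of ones and \<open>m = n - b\<close>. Triples with two ones
  number at most \<open>b\<^sup>2 m / 4\<close>. A one with \<open>p\<close> zeros and \<open>q\<close> twos on its left, in a word with
  \<open>a\<close> zeros and \<open>c\<close> twos in all, lies in
  \<open>(a + c)\<^sup>2 / 4 - (p - q - (a - c) / 2)\<^sup>2\<close> non-monotone triples without another one, which is at
  most \<open>m\<^sup>2 / 4\<close>. The same squares show that at most
  \<open>m\<^sup>3 / 24\<close> non-monotone triples avoid the letter one. Maximising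
  \<open>b\<^sup>2 m / 4 + b m\<^sup>2 / 4 + m\<^sup>3 / 24\<close> over \<open>b + m = n\<close> gives \<open>(\<surd>2 - 1) n\<^sup>3 / 6\<close>,
  attained at \<open>b = (\<surd>2 - 1) n\<close>. The words \<open>1\<dots>1 0202\<dots>02 1\<dots>1\<close>, with the ones split evenly,
  show that the bound is asymptotically sharp.\<close>

section \<open>Non-monotone triples, listed by middle position\<close>

definition num_turns :: "(nat \<Rightarrow> nat) \<Rightarrow> nat \<Rightarrow> nat" where
  "num_turns u n = (\<Sum>j<n.
     card {i. i < j \<and> u i < u j} * card {k. j < k \<and> k < n \<and> u k < u j} +
     card {i. i < j \<and> u j < u i} * card {k. j < k \<and> k < n \<and> u j < u k})"

definition letter_count :: "(nat \<Rightarrow> nat) \<Rightarrow> nat \<Rightarrow> nat \<Rightarrow> nat" where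
  "letter_count u x j = card {i. i < j \<and> u i = x}"

lemma nths_triple:
  assumes "i < j" "j < k" "k < n"
  shows "nths (map u [0..<n]) {i, j, k} = [u i, u j, u k]"
proof -
  have "nths (map u [0..<n]) A = map u (filter (\<lambda>x. x \<in> A) [0..<n])" for A
    by (induction n) (auto simp: nths_append nths_singleton)
  moreover have "filter (\<lambda>x. x \<in> {i, j, k}) [0..<n] = [i, j, k]"
  proof (rule sorted_distinct_set_unique)
    show "sorted (filter (\<lambda>x. x \<in> {i, j, k}) [0..<n])"
      by (rule sorted_wrt_filter) simp
  qed (use assms in auto)
  ultimately show ?thesis
    by simp
qed

lemma not_monotone_word_triple:
  "\<not> monotone_word [x, y, z] \<longleftrightarrow> x < y \<and> z < y \<or> y < x \<and> y < z"
  by (auto simp: monotone_word_def)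

lemma card_3_ordered:
  fixes I :: "nat set"
  assumes "card I = 3"
  obtains i j k where "I = {i, j, k}" "i < j" "j < k"
proof -
  have fin: "finite I"
    using assms card.infinite by fastforce
  define l where "l = sorted_list_of_set I"
  have "length l = 3"
    using assms by (simp add: l_def)
  then obtain i j k where l: "l = [i, j, k]"
    by (auto simp: numeral_3_eq_3 length_Suc_conv)
  have "sorted_wrt (<) l" "set l = I"
    using fin by (simp_all only: l_def strict_sorted_list_of_set set_sorted_list_of_set)
  then show thesis
    using that l by auto
qed

text \<open>Every 3-set of positions has a unique middle element, so the map \<open>g\<close> that
  forgets the order is a bijection from the triples counted in \<open>num_turns\<close> onto the
  non-monotone 3-sets.\<close>

lemma num_monotone_3_plus_num_turns:
  "num_monotone 3 (map u [0..<n]) + num_turns u n = n choose 3"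
proof -
  let ?w = "map u [0..<n]"
  define M where "M = {I. I \<subseteq> {..<n} \<and> card I = 3 \<and> monotone_word (nths ?w I)}"
  define N where "N = {I. I \<subseteq> {..<n} \<and> card I = 3 \<and> \<not> monotone_word (nths ?w I)}"
  define P where "P j =
     {i. i < j \<and> u i < u j} \<times> {k. j < k \<and> k < n \<and> u k < u j} \<union>
     {i. i < j \<and> u j < u i} \<times> {k. j < k \<and> k < n \<and> u j < u k}" for j
  define g where "g = (\<lambda>(j, i, k). {i, j, k :: nat})"
  have fin: "finite {I. I \<subseteq> {..<n} \<and> card I = 3}"
    by (rule finite_subset[of _ "Pow {..<n}"]) auto
  have "n choose 3 = card {I. I \<subseteq> {..<n} \<and> card I = 3}"
    using n_subsets[of "{..<n}" 3] by simp
  also have "{I. I \<subseteq> {..<n} \<and> card I = 3} = M \<union> N"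
    by (auto simp: M_def N_def)
  also have "card (M \<union> N) = card M + card N"
    by (rule card_Un_disjoint) (auto simp: M_def N_def intro: finite_subset[OF _ fin])
  finally have total: "n choose 3 = card M + card N" .
  have "N = g ` (Sigma {..<n} P)"
  proof (intro equalityI subsetI)
    fix I assume I: "I \<in> N"
    then obtain i j k where ijk: "I = {i, j, k}" "i < j" "j < k"
      by (auto simp: N_def elim: card_3_ordered)
    with I have "k < n" "\<not> monotone_word [u i, u j, u k]"
      by (auto simp: N_def nths_triple)
    with ijk have "(j, i, k) \<in> Sigma {..<n} P"
      by (auto simp: P_def not_monotone_word_triple)
    then have "g (j, i, k) \<in> g ` Sigma {..<n} P"
      by (rule imageI)
    with ijk show "I \<in> g ` Sigma {..<n} P"
      by (simp add: g_def)
  next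
    fix I assume "I \<in> g ` Sigma {..<n} P"
    then obtain i j k where "I = {i, j, k}" "i < j" "j < k" "k < n"
      "u i < u j \<and> u k < u j \<or> u j < u i \<and> u j < u k"
      by (auto simp: g_def P_def)
    then show "I \<in> N"
      by (auto simp: N_def nths_triple not_monotone_word_triple)
  qed
  moreover have "inj_on g (Sigma {..<n} P)"
  proof (rule inj_onI)
    fix x y assume xy: "x \<in> Sigma {..<n} P" "y \<in> Sigma {..<n} P" "g x = g y"
    obtain j i k j' i' k' where "x = (j, i, k)" "y = (j', i', k')"
      by (metis prod.exhaust)
    moreover from this xy have "i < j" "j < k" "i' < j'" "j' < k'" "{i, j, k} = {i', j', k'}"
      by (auto simp: g_def P_def)
    \<comment> \<open>A set has only one increasing enumeration, so it determines its middle
      element.\<close>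
    moreover from this have "[i, j, k] = [i', j', k']"
      by (intro sorted_distinct_set_unique) auto
    ultimately show "x = y"
      by simp
  qed
  ultimately have "card N = card (Sigma {..<n} P)"
    by (simp add: card_image)
  also have "\<dots> = (\<Sum>j<n. card (P j))"
    by (subst card_SigmaI) (auto simp: P_def)
  also have "\<dots> = num_turns u n"
    unfolding num_turns_def P_def
  proof (rule sum.cong)
    fix j
    show "card ({i. i < j \<and> u i < u j} \<times> {k. j < k \<and> k < n \<and> u k < u j} \<union>
        {i. i < j \<and> u j < u i} \<times> {k. j < k \<and> k < n \<and> u j < u k}) =
      card {i. i < j \<and> u i < u j} * card {k. j < k \<and> k < n \<and> u k < u j} +
      card {i. i < j \<and> u j < u i} * card {k. j < k \<and> k < n \<and> u j < u k}"
      by (subst card_Un_disjoint) (auto simp: card_cartesian_product)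
  qed simp
  finally show ?thesis
    using total by (simp add: num_monotone_def M_def)
qed

section \<open>Letter counts of prefixes and the turns at one position\<close>

lemma letter_count_0 [simp]: "letter_count u x 0 = 0"
  by (simp add: letter_count_def)

lemma letter_count_Suc [simp]:
  "letter_count u x (Suc j) = letter_count u x j + (if u j = x then 1 else 0)"
proof -
  have "{i. i < Suc j \<and> u i = x} =
      (if u j = x then insert j {i. i < j \<and> u i = x} else {i. i < j \<and> u i = x})"
    by (auto simp: less_Suc_eq)
  then show ?thesis
    by (simp add: letter_count_def)
qed

lemma card_letter_after:
  assumes "j < n" "u j \<noteq> x"
  shows "real (card {k. j < k \<and> k < n \<and> u k = x}) =
    real (letter_count u x n) - real (letter_count u x j)"
proof -
  have "{i. i < n \<and> u i = x} = {i. i < j \<and> u i = x} \<union> {k. j < k \<and> k < n \<and> u k = x}"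
    using assms by (auto simp: not_less_iff_gr_or_eq)
  moreover have "card ({i. i < j \<and> u i = x} \<union> {k. j < k \<and> k < n \<and> u k = x}) =
      card {i. i < j \<and> u i = x} + card {k. j < k \<and> k < n \<and> u k = x}"
    by (rule card_Un_disjoint) auto
  ultimately show ?thesis
    by (simp add: letter_count_def)
qed

lemma card_Collect_eq_or:
  assumes "finite {k :: nat. P k}" "x \<noteq> y"
  shows "card {k. P k \<and> (u k = x \<or> u k = y)} =
    card {k. P k \<and> u k = x} + card {k. P k \<and> u k = y}"
proof -
  have "{k. P k \<and> (u k = x \<or> u k = y)} = {k. P k \<and> u k = x} \<union> {k. P k \<and> u k = y}"
    by auto
  then show ?thesis
    using assms by (simp add: card_Un_disjoint disjoint_iff)
qed

text \<open>A zero can only be a strict minimum and a two only a strict maximum, which leaves one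
  product each; a one is a maximum between zeros or a minimum between twos. Real values avoid
  truncated subtraction.\<close>

definition turns_at :: "(nat \<Rightarrow> nat) \<Rightarrow> nat \<Rightarrow> nat \<Rightarrow> real" where
  "turns_at u n j =
    (let p = real (letter_count u 0 j); a = real (letter_count u 0 n);
         r = real (letter_count u 1 j); b = real (letter_count u 1 n);
         q = real (letter_count u 2 j); c = real (letter_count u 2 n)
     in if u j = 0 then (q + r) * ((c - q) + (b - r))
        else if u j = 1 then p * (a - p) + q * (c - q)
        else (p + r) * ((a - p) + (b - r)))"

lemma num_turns_eq_sum_turns_at:
  assumes u: "\<And>i. i < n \<Longrightarrow> u i < 3"
  shows "real (num_turns u n) = (\<Sum>j<n. turns_at u n j)"
  unfolding num_turns_def of_nat_sum
proof (rule sum.cong)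
  fix j assume "j \<in> {..<n}"
  then have j: "j < n"
    by simp
  have letters: "u i = 0 \<or> u i = 1 \<or> u i = 2" if "i < n" for i
    using u[OF that] by auto
  have left: "{i. i < j \<and> Q (u i)} = {i. i < j \<and> (u i = x \<or> u i = y)}"
    if "\<And>v. v < 3 \<Longrightarrow> Q v \<longleftrightarrow> v = x \<or> v = y" for Q x y
    using that u j by (metis (lifting) order.strict_trans)
  have right: "{k. j < k \<and> k < n \<and> Q (u k)} = {k. (j < k \<and> k < n) \<and> (u k = x \<or> u k = y)}"
    if "\<And>v. v < 3 \<Longrightarrow> Q v \<longleftrightarrow> v = x \<or> v = y" for Q x y
    using that u by blast
  have lc: "card {i. i < j \<and> (u i = x \<or> u i = y)} = letter_count u x j + letter_count u y j"
    if "x \<noteq> y" for x y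
    using that by (simp add: card_Collect_eq_or letter_count_def)
  have rc: "real (card {k. (j < k \<and> k < n) \<and> (u k = x \<or> u k = y)}) =
      (letter_count u x n - real (letter_count u x j)) +
      (letter_count u y n - real (letter_count u y j))"
    if "x \<noteq> y" "u j \<noteq> x" "u j \<noteq> y" for x y
  proof -
    have "card {k. (j < k \<and> k < n) \<and> (u k = x \<or> u k = y)} =
        card {k. (j < k \<and> k < n) \<and> u k = x} + card {k. (j < k \<and> k < n) \<and> u k = y}"
      using that by (intro card_Collect_eq_or) auto
    then show ?thesis
      using that j card_letter_after[of j n u x] card_letter_after[of j n u y] by simp
  qed
  consider "u j = 0" | "u j = 1" | "u j = 2"
    using letters[OF j] by auto
  then show "real (card {i. i < j \<and> u i < u j} * card {k. j < k \<and> k < n \<and> u k < u j} +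
      card {i. i < j \<and> u j < u i} * card {k. j < k \<and> k < n \<and> u j < u k}) = turns_at u n j"
  proof cases
    case 1
    have "{i. i < j \<and> u j < u i} = {i. i < j \<and> (u i = 2 \<or> u i = 1)}"
      unfolding 1 by (rule left[where Q = "\<lambda>v. 0 < v"]) auto
    moreover have "{k. j < k \<and> k < n \<and> u j < u k} =
        {k. (j < k \<and> k < n) \<and> (u k = 2 \<or> u k = 1)}"
      unfolding 1 by (rule right[where Q = "\<lambda>v. 0 < v"]) auto
    ultimately show ?thesis
      using 1 lc[of 2 1] rc[of 2 1] by (simp add: turns_at_def Let_def)
  next
    case 2
    \<comment> \<open>The doubled disjunct puts a single letter into the two-letter shape that
      \<open>left\<close> and \<open>right\<close> expect.\<close>
    have v: "1 < v \<longleftrightarrow> v = 2 \<or> v = 2" "v < 1 \<longleftrightarrow> v = 0 \<or> v = 0" if "v < 3" for v :: nat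
      using that by auto
    have "{i. i < j \<and> u j < u i} = {i. i < j \<and> u i = 2}"
      "{i. i < j \<and> u i < u j} = {i. i < j \<and> u i = 0}"
      "{k. j < k \<and> k < n \<and> u j < u k} = {k. j < k \<and> k < n \<and> u k = 2}"
      "{k. j < k \<and> k < n \<and> u k < u j} = {k. j < k \<and> k < n \<and> u k = 0}"
      unfolding 2
      using left[OF v(1)] left[OF v(2)] right[OF v(1)] right[OF v(2)] by simp_all
    then show ?thesis
      using 2 j card_letter_after[of j n u 0] card_letter_after[of j n u 2]
      by (simp add: turns_at_def Let_def letter_count_def)
  next
    case 3
    have "{i. i < j \<and> u i < u j} = {i. i < j \<and> (u i = 0 \<or> u i = 1)}"
      unfolding 3 by (rule left[where Q = "\<lambda>v. v < 2"]) auto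
    moreover have "{k. j < k \<and> k < n \<and> u k < u j} =
        {k. (j < k \<and> k < n) \<and> (u k = 0 \<or> u k = 1)}"
      unfolding 3 by (rule right[where Q = "\<lambda>v. v < 2"]) auto
    moreover have "\<not> 2 < u i" if "i < j" for i
      using u[of i] that j by auto
    then have "{i. i < j \<and> u j < u i} = {}"
      using 3 by auto
    ultimately show ?thesis
      using 3 lc[of 0 1] rc[of 0 1] by (simp add: turns_at_def Let_def)
  qed
qed simp

section \<open>Upper bound on the turns by a potential\<close>

text \<open>A potential on prefixes with \<open>p\<close> zeros, \<open>r\<close> ones and \<open>q\<close> twos, in a word with totals
  \<open>a\<close>, \<open>b\<close>, \<open>c\<close>. The three lines account for triples with two, one and no ones. The last one is
  found by integrating \<open>q (c - q) + e\<^sup>2 / 2\<close> in \<open>p\<close> and \<open>p (a - p) + e\<^sup>2 / 2\<close> in \<open>q\<close>, where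
  \<open>e = p - q - (a - c) / 2\<close>; the factor \<open>1 / 2\<close> is the one making these two compatible.\<close>

definition turn_potential :: "real \<Rightarrow> real \<Rightarrow> real \<Rightarrow> real \<Rightarrow> real \<Rightarrow> real \<Rightarrow> real" where
  "turn_potential a b c p r q =
    b\<^sup>2 / 4 * (p + q)
    + (b * p * q - 2 * p * q * r + r * (p * c + q * a) + r * (a - c)\<^sup>2 / 4)
    + (p * q * c - p * q\<^sup>2 + (p - q - (a - c) / 2)^3 / 6
       + q^3 / 3 + q * (a - c)\<^sup>2 / 4 + q\<^sup>2 * (a - c) / 2)"

text \<open>The square of \<open>b / 2 - r\<close> is the slack in bounding
  \<open>r * (b - r)\<close> by a quarter of the square of \<open>b\<close>. The shift
  \<open>1 / 2\<close> and the constant \<open>1 / 24\<close> come from a unit difference of a cube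
  replacing its derivative: ((e + 1)^3 - e^3) / 6 = (e + 1/2)^2 / 2 + 1/24.\<close>

lemma turn_potential_step_0:
  "(q + r) * ((c - q) + (b - r)) \<le> turn_potential a b c (p + 1) r q - turn_potential a b c p r q"
proof -
  have "turn_potential a b c (p + 1) r q - turn_potential a b c p r q - (q + r) * ((c - q) + (b - r))
    = (b / 2 - r)\<^sup>2 + (p - q - (a - c) / 2 + 1 / 2)\<^sup>2 / 2 + 1 / 24"
    unfolding turn_potential_def by (simp add: field_simps power2_eq_square power3_eq_cube)
  then show ?thesis
    by (smt (verit) divide_nonneg_nonneg zero_le_power2)
qed

text \<open>The slack is a single square, which vanishes at the ones of the extremal words, where
  \<open>p = q\<close> and \<open>a = c\<close>.\<close>

lemma turn_potential_step_1:
  "p * (a - p) + q * (c - q) \<le> turn_potential a b c p (r + 1) q - turn_potential a b c p r q"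
proof -
  have "turn_potential a b c p (r + 1) q - turn_potential a b c p r q - (p * (a - p) + q * (c - q))
    = (p - q - (a - c) / 2)\<^sup>2"
    unfolding turn_potential_def by (simp add: field_simps power2_eq_square power3_eq_cube)
  then show ?thesis
    by (smt (verit) zero_le_power2)
qed

text \<open>Mirror image of the step for a zero: a two lowers \<open>p - q\<close> by one, so the
  shift is \<open>- 1 / 2\<close>.\<close>

lemma turn_potential_step_2:
  "(p + r) * ((a - p) + (b - r)) \<le> turn_potential a b c p r (q + 1) - turn_potential a b c p r q"
proof -
  have "turn_potential a b c p r (q + 1) - turn_potential a b c p r q - (p + r) * ((a - p) + (b - r))
    = (b / 2 - r)\<^sup>2 + (p - q - (a - c) / 2 - 1 / 2)\<^sup>2 / 2 + 1 / 24"
    unfolding turn_potential_def by (simp add: field_simps power2_eq_square power3_eq_cube)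
  then show ?thesis
    by (smt (verit) divide_nonneg_nonneg zero_le_power2)
qed

text \<open>The total growth depends on \<open>a\<close> and \<open>c\<close> only through their
  sum, which leaves a maximisation over \<open>b\<close> and \<open>a + c\<close>.\<close>

lemma turn_potential_total:
  "turn_potential a b c a b c - turn_potential a b c 0 0 0
    = b\<^sup>2 * (a + c) / 4 + b * (a + c)\<^sup>2 / 4 + (a + c)^3 / 24"
  unfolding turn_potential_def by (simp add: field_simps power2_eq_square power3_eq_cube)

lemma cubic_bound:
  fixes b m :: real
  assumes "0 \<le> b" "0 \<le> m"
  shows "b\<^sup>2 * m / 4 + b * m\<^sup>2 / 4 + m^3 / 24 \<le> (sqrt 2 - 1) / 6 * (b + m)^3"
proof -
  define s where "s = sqrt 2"
  have s: "s * s = 2" "s > 0"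
    by (auto simp: s_def)
  \<comment> \<open>Normalisation nests products to the right, where \<open>s * s\<close> need not
    occur as a subterm.\<close>
  have ss: "s * (s * x) = 2 * x" for x
    using s(1) by (simp flip: mult.assoc)
  \<comment> \<open>The deficit has a double root at the optimal ratio \<open>b = (s - 1) (b + m)\<close>.\<close>
  have "0 \<le> (b - (s - 1) * (b + m))\<^sup>2 * (b + (2 * s + 1) * (b + m))"
    using assms s by (intro mult_nonneg_nonneg add_nonneg_nonneg) auto
  also have "\<dots> = 24 * ((s - 1) / 6 * (b + m)^3 - (b\<^sup>2 * m / 4 + b * m\<^sup>2 / 4 + m^3 / 24))"
    by (simp add: field_simps power2_eq_square power3_eq_cube s(1) ss)
  finally show ?thesis
    by (simp add: s_def)
qed

text \<open>Each letter raises one prefix count by one, so the potential grows by at least the turns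
  at that position and the sum telescopes.\<close>

lemma num_turns_le:
  assumes u: "\<And>i. i < n \<Longrightarrow> u i < 3"
  shows "real (num_turns u n) \<le> (sqrt 2 - 1) / 6 * real n ^ 3"
proof -
  define a b c where "a = real (letter_count u 0 n)" and "b = real (letter_count u 1 n)"
    and "c = real (letter_count u 2 n)"
  define G where "G j = turn_potential a b c (letter_count u 0 j) (letter_count u 1 j)
    (letter_count u 2 j)" for j
  have "real (num_turns u n) = (\<Sum>j<n. turns_at u n j)"
    using u by (rule num_turns_eq_sum_turns_at)
  also have "\<dots> \<le> (\<Sum>j<n. G (Suc j) - G j)"
  proof (rule sum_mono)
    fix j assume "j \<in> {..<n}"
    then have "u j = 0 \<or> u j = 1 \<or> u j = 2"
      using u[of j] by auto
    then show "turns_at u n j \<le> G (Suc j) - G j"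
    proof (elim disjE)
      assume j: "u j = 0"
      then have "G (Suc j) = turn_potential a b c (real (letter_count u 0 j) + 1) (letter_count u 1 j) (letter_count u 2 j)"
        by (simp add: G_def add.commute del: One_nat_def)
      then show ?thesis
        using turn_potential_step_0[of "letter_count u 2 j" "letter_count u 1 j" c b a "letter_count u 0 j"] j
        by (simp add: turns_at_def Let_def G_def del: One_nat_def flip: a_def b_def c_def)
    next
      assume j: "u j = 1"
      then have "G (Suc j) = turn_potential a b c (letter_count u 0 j) (real (letter_count u 1 j) + 1) (letter_count u 2 j)"
        by (simp add: G_def add.commute del: One_nat_def)
      then show ?thesis
        using turn_potential_step_1[of "letter_count u 0 j" a "letter_count u 2 j" c b "letter_count u 1 j"] j
        by (simp add: turns_at_def Let_def G_def del: One_nat_def flip: a_def b_def c_def)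
    next
      assume j: "u j = 2"
      then have "G (Suc j) = turn_potential a b c (letter_count u 0 j) (letter_count u 1 j) (real (letter_count u 2 j) + 1)"
        by (simp add: G_def add.commute del: One_nat_def)
      then show ?thesis
        using turn_potential_step_2[of "letter_count u 0 j" "letter_count u 1 j" a b c "letter_count u 2 j"] j
        by (simp add: turns_at_def Let_def G_def del: One_nat_def flip: a_def b_def c_def)
    qed
  qed
  also have "\<dots> = G n - G 0"
    by (rule sum_lessThan_telescope)
  also have "\<dots> = b\<^sup>2 * (a + c) / 4 + b * (a + c)\<^sup>2 / 4 + (a + c)^3 / 24"
    using turn_potential_total[of a b c] by (simp add: G_def a_def b_def c_def)
  also have "\<dots> \<le> (sqrt 2 - 1) / 6 * (b + (a + c))^3"
    by (rule cubic_bound) (auto simp: a_def b_def c_def)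
  also have "b + (a + c) = real n"
  proof -
    have "letter_count u 1 j + (letter_count u 0 j + letter_count u 2 j) = j" if "j \<le> n" for j
      using that
    proof (induction j)
      case (Suc j)
      then show ?case
        using u[of j] by auto
    qed simp
    from this[of n] show ?thesis
      unfolding a_def b_def c_def by linarith
  qed
  finally show ?thesis .
qed

section \<open>Words attaining the bound asymptotically\<close>

text \<open>The ones after the \<open>k\<close> blocks 02 never end, so one function serves every
  length \<open>n\<close>; the final run has at least \<open>h\<close> ones once
  \<open>2 * h + 2 * k \<le> n\<close>.\<close>

definition extremal_word :: "nat \<Rightarrow> nat \<Rightarrow> nat \<Rightarrow> nat" where
  "extremal_word h k j = (if j < h \<or> h + 2 * k \<le> j then 1 else if even (j - h) then 0 else 2)"

lemma letter_count_extremal_word: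
  assumes "i \<le> k"
  shows "letter_count (extremal_word h k) 0 (h + 2 * i) = i"
    "letter_count (extremal_word h k) 1 (h + 2 * i) = h"
    "letter_count (extremal_word h k) 2 (h + 2 * i) = i"
proof -
  let ?u = "extremal_word h k"
  have "letter_count ?u 0 j = 0 \<and> letter_count ?u 1 j = j \<and> letter_count ?u 2 j = 0" if "j \<le> h" for j
    using that by (induction j) (auto simp: extremal_word_def)
  then have "letter_count ?u 0 (h + 2 * i) = i \<and> letter_count ?u 1 (h + 2 * i) = h \<and>
      letter_count ?u 2 (h + 2 * i) = i"
    using assms
  proof (induction i)
    case (Suc i)
    then show ?case
      by (simp add: extremal_word_def)
  qed simp
  then show "letter_count ?u 0 (h + 2 * i) = i" "letter_count ?u 1 (h + 2 * i) = h"
    "letter_count ?u 2 (h + 2 * i) = i"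
    by auto
qed

lemma letter_count_extremal_word_tail:
  assumes "h + 2 * k \<le> n"
  shows "letter_count (extremal_word h k) 0 n = k"
    "letter_count (extremal_word h k) 1 n = n - 2 * k"
    "letter_count (extremal_word h k) 2 n = k"
proof -
  let ?u = "extremal_word h k"
  have "letter_count ?u 0 n = k \<and> letter_count ?u 1 n = n - 2 * k \<and> letter_count ?u 2 n = k"
    using assms
  proof (induction n rule: dec_induct)
    case base
    then show ?case
      using letter_count_extremal_word[of k k h] by simp
  next
    case (step n)
    then show ?case
      by (auto simp: extremal_word_def)
  qed
  then show "letter_count ?u 0 n = k" "letter_count ?u 1 n = n - 2 * k" "letter_count ?u 2 n = k"
    by auto
qed

lemma sum_pairs_lessThan:
  fixes f :: "nat \<Rightarrow> real"
  shows "(\<Sum>j<2 * k. f j) = (\<Sum>i<k. f (2 * i) + f (2 * i + 1))"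
  by (induction k) auto

text \<open>Only turns inside the alternating block are counted, and the ones after it are rounded
  down to \<open>h\<close>, which makes the bound independent of \<open>n\<close>.\<close>

lemma num_turns_extremal_word_ge:
  assumes n: "2 * h + 2 * k \<le> n"
  shows "real h * k * (2 * real k + 2 * real h - 1) + real k * (real k - 1) * (2 * real k - 1) / 6
    \<le> num_turns (extremal_word h k) n"
proof -
  let ?u = "extremal_word h k"
  note count = letter_count_extremal_word letter_count_extremal_word_tail
  \<comment> \<open>The limit \<open>K\<close> is kept apart from the \<open>k\<close> in the
    summand, so that the induction moves only the limit.\<close>
  have "(\<Sum>i<K. (real i + real h) * (2 * real k + 2 * real h - 1 - 2 * real i)) =
      real h * (2 * real k + 2 * real h - 1) * real K + (2 * real k - 1) * K * (real K - 1) / 2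
      - real K * (real K - 1) * (2 * real K - 1) / 3" for K
    by (induction K) (auto simp: field_simps)
  from this[of k] have "(\<Sum>i<k. (real i + real h) * (2 * real k + 2 * real h - 1 - 2 * real i)) =
      real h * k * (2 * real k + 2 * real h - 1) + real k * (real k - 1) * (2 * real k - 1) / 6"
    by (simp only:) (simp add: field_simps)
  then have "real h * k * (2 * real k + 2 * real h - 1) + real k * (real k - 1) * (2 * real k - 1) / 6
    = (\<Sum>i<k. (real i + real h) * (2 * real k + 2 * real h - 1 - 2 * real i))"
    by (rule sym)
  also have "\<dots> \<le> (\<Sum>i<k. turns_at ?u n (h + 2 * i) + turns_at ?u n (h + (2 * i + 1)))"
  proof (rule sum_mono)
    fix i assume "i \<in> {..<k}"
    then have i: "i < k"
      by simp
    have u: "?u (h + 2 * i) = 0" "?u (h + (2 * i + 1)) = 2"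
      using i by (auto simp: extremal_word_def)
    \<comment> \<open>\<open>B\<close> is the number of ones after the alternating block.\<close>
    define B where "B = real (n - 2 * k) - h"
    have B: "real h \<le> B"
      using n by (simp add: B_def)
    have "turns_at ?u n (h + 2 * i) = (real i + h) * (real k - i + B)"
      using n i u by (simp add: turns_at_def count B_def Let_def del: One_nat_def)
    moreover have "letter_count ?u 0 (h + (2 * i + 1)) = i + 1"
      "letter_count ?u 1 (h + (2 * i + 1)) = h"
      using i u(1) letter_count_extremal_word[of i k h] by auto
    then have "turns_at ?u n (h + (2 * i + 1)) =
        (real (i + 1) + h) * (real k - real (i + 1) + (real (n - 2 * k) - h))"
      using n u(2) letter_count_extremal_word_tail[of h k n]
      by (simp add: turns_at_def Let_def del: One_nat_def)
    then have "turns_at ?u n (h + (2 * i + 1)) = (real i + 1 + h) * (real k - i - 1 + B)"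
      by (simp add: B_def algebra_simps)
    moreover have "(real i + h) * (real k - i + h) \<le> (real i + h) * (real k - i + B)"
      using B by (intro mult_left_mono) auto
    \<comment> \<open>Lowering \<open>i + 1 + h\<close> to \<open>i + h\<close> lets both products
      of a block share a factor, at a total cost only quadratic in \<open>n\<close>.\<close>
    moreover have "(real i + h) * (real k - i - 1 + h) \<le> (real i + 1 + h) * (real k - i - 1 + B)"
      using B i by (intro mult_mono) auto
    ultimately show "(real i + real h) * (2 * real k + 2 * real h - 1 - 2 * real i)
        \<le> turns_at ?u n (h + 2 * i) + turns_at ?u n (h + (2 * i + 1))"
      by (simp add: algebra_simps)
  qed
  also have "\<dots> = (\<Sum>j<2 * k. turns_at ?u n (h + j))"
    using sum_pairs_lessThan[of "\<lambda>j. turns_at ?u n (h + j)" k] by simp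
  also have "\<dots> = (\<Sum>j\<in>{h..<h + 2 * k}. turns_at ?u n j)"
    by (rule sum.reindex_bij_witness[of _ "\<lambda>j. j - h" "\<lambda>j. h + j"]) auto
  \<comment> \<open>The other positions hold ones with all zeros and twos on one side, so dropping
    them loses nothing.\<close>
  also have "\<dots> \<le> (\<Sum>j<n. turns_at ?u n j)"
  proof (rule sum_mono2)
    fix j
    have mono: "letter_count ?u x i \<le> letter_count ?u x n" if "i \<le> n" for x i
      unfolding letter_count_def using that by (intro card_mono) auto
    assume "j \<in> {..<n} - {h..<h + 2 * k}"
    then show "0 \<le> turns_at ?u n j"
      using mono[of j] by (simp add: turns_at_def Let_def)
  qed (use n in auto)
  also have "\<dots> = num_turns ?u n"
    by (rule num_turns_eq_sum_turns_at[symmetric]) (simp add: extremal_word_def)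
  finally show ?thesis .
qed

section \<open>From turn counts to bounds on the minimal density\<close>

lemma finite_words: "finite (words s n)"
  using finite_lists_length_eq[of "{..<s}" n] by (simp add: words_def conj_commute)

lemma density_eq_num_turns:
  assumes "n \<ge> 3"
  shows "real (num_monotone 3 (map u [0..<n])) / real (n choose 3) =
    1 - real (num_turns u n) / real (n choose 3)"
proof -
  have "real (n choose 3) = real (num_monotone 3 (map u [0..<n])) + real (num_turns u n)"
    using num_monotone_3_plus_num_turns[of u n] by linarith
  moreover have "real (n choose 3) \<noteq> 0"
    using assms by simp
  ultimately show ?thesis
    by (simp add: field_simps)
qed

lemma min_density_3_3_ge:
  assumes "n \<ge> 3"
  shows "1 - (sqrt 2 - 1) / 6 * real n ^ 3 / real (n choose 3) \<le> min_density 3 3 n"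
  unfolding min_density_def
proof (rule Min.boundedI)
  show "(\<lambda>w. real (num_monotone 3 w) / real (n choose 3)) ` words 3 n \<noteq> {}"
    by (auto simp: words_def intro!: exI[of _ "replicate n 0"])
next
  fix x assume "x \<in> (\<lambda>w. real (num_monotone 3 w) / real (n choose 3)) ` words 3 n"
  then obtain w where w: "length w = n" "set w \<subseteq> {..<3}"
      and x: "x = real (num_monotone 3 w) / real (n choose 3)"
    by (auto simp: words_def)
  \<comment> \<open>Turns are counted for functions on positions, so the list is read through its
    indexing function.\<close>
  have "w = map ((!) w) [0..<n]"
    using w(1) map_nth[of w] by simp
  then have "x = 1 - real (num_turns ((!) w) n) / real (n choose 3)"
    using x density_eq_num_turns[OF assms, of "(!) w"] by simp
  moreover have "real (num_turns ((!) w) n) \<le> (sqrt 2 - 1) / 6 * real n ^ 3"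
    using w by (intro num_turns_le) (auto dest: nth_mem)
  ultimately show "1 - (sqrt 2 - 1) / 6 * real n ^ 3 / real (n choose 3) \<le> x"
    using divide_right_mono[of "real (num_turns ((!) w) n)" _ "real (n choose 3)"] by fastforce
qed (simp add: finite_words)

lemma min_density_3_3_le:
  assumes "n \<ge> 3" "2 * h + 2 * k \<le> n"
  shows "min_density 3 3 n \<le> 1 - (real h * k * (2 * real k + 2 * real h - 1) +
    real k * (real k - 1) * (2 * real k - 1) / 6) / real (n choose 3)"
proof -
  let ?w = "map (extremal_word h k) [0..<n]"
  have "?w \<in> words 3 n"
    by (auto simp: words_def extremal_word_def)
  then have "min_density 3 3 n \<le> real (num_monotone 3 ?w) / real (n choose 3)"
    unfolding min_density_def by (intro Min_le) (auto simp: finite_words)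
  also have "\<dots> = 1 - real (num_turns (extremal_word h k) n) / real (n choose 3)"
    using assms(1) by (rule density_eq_num_turns)
  also have "\<dots> \<le> 1 - (real h * k * (2 * real k + 2 * real h - 1) +
    real k * (real k - 1) * (2 * real k - 1) / 6) / real (n choose 3)"
    using num_turns_extremal_word_ge[OF assms(2)] by (simp add: divide_right_mono)
  finally show ?thesis .
qed

section \<open>Asymptotics and the limit\<close>

lemma real_choose_3: "real (n choose 3) = real n * (real n - 1) * (real n - 2) / 6"
  by (simp add: binomial_gbinomial gbinomial_prod_rev numeral_3_eq_3 fact_numeral)

lemma tendsto_nat_floor_mult_over:
  fixes c :: real
  assumes "c \<ge> 0"
  shows "(\<lambda>n. real (nat \<lfloor>c * real n\<rfloor>) / real n) \<longlonglongrightarrow> c"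
proof (rule tendsto_sandwich)
  show "(\<lambda>n. c - 1 / real n) \<longlonglongrightarrow> c"
    using tendsto_diff[OF tendsto_const lim_1_over_n, of c] by simp
  show "\<forall>\<^sub>F n in sequentially. c - 1 / real n \<le> real (nat \<lfloor>c * real n\<rfloor>) / real n"
    using eventually_gt_at_top[of 0]
  proof eventually_elim
    case (elim n)
    have "c * real n - 1 \<le> real (nat \<lfloor>c * real n\<rfloor>)"
      using assms by linarith
    then have "(c * real n - 1) / real n \<le> real (nat \<lfloor>c * real n\<rfloor>) / real n"
      by (rule divide_right_mono) simp
    then show ?case
      using elim by (simp add: diff_divide_distrib)
  qed
  show "\<forall>\<^sub>F n in sequentially. real (nat \<lfloor>c * real n\<rfloor>) / real n \<le> c"
    using eventually_gt_at_top[of 0]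
  proof eventually_elim
    case (elim n)
    have "real (nat \<lfloor>c * real n\<rfloor>) \<le> c * real n"
      using assms by (simp add: of_nat_floor)
    then show ?case
      using elim by (simp add: field_simps)
  qed
qed simp

lemma min_density_3_3_tendsto: "min_density 3 3 \<longlonglongrightarrow> 2 - sqrt 2"
proof -
  define s where "s = sqrt 2"
  have s: "s * s = 2" "1 \<le> s" "s \<le> 2"
    by (auto simp: s_def intro: real_le_lsqrt)
  have ss: "s * (s * x) = 2 * x" for x
    using s(1) by (simp flip: mult.assoc)
  \<comment> \<open>The optimal fraction \<open>s - 1\<close> of ones is halved between the two
    ends, and the remaining \<open>2 - s\<close> is shared equally by zeros and twos. Rounding down
    keeps the word within length \<open>n\<close>.\<close>
  define h k where "h n = nat \<lfloor>(s - 1) / 2 * real n\<rfloor>" and "k n = nat \<lfloor>(1 - s / 2) * real n\<rfloor>" for n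
  define x y where "x n = real (h n) / real n" and "y n = real (k n) / real n" for n
  have x: "x \<longlonglongrightarrow> (s - 1) / 2" and y: "y \<longlonglongrightarrow> 1 - s / 2"
    unfolding x_def y_def h_def k_def using s by (intro tendsto_nat_floor_mult_over; simp)+
  have hk: "2 * h n + 2 * k n \<le> n" for n
  proof -
    have "real (h n) \<le> (s - 1) / 2 * real n" "real (k n) \<le> (1 - s / 2) * real n"
      unfolding h_def k_def using s by (intro of_nat_floor; simp)+
    then have "2 * real (h n) + 2 * real (k n) \<le> real n"
      by (simp add: algebra_simps)
    then show ?thesis
      by linarith
  qed
  \<comment> \<open>This is \<open>n choose 3\<close> divided by \<open>n ^ 3\<close>, for
    \<open>n \<ge> 3\<close>.\<close>
  let ?C = "\<lambda>n. (1 - 1 / real n) * (1 - 2 / real n) / 6"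
  have inv: "(\<lambda>n. 1 / real n) \<longlonglongrightarrow> 0"
    by (rule lim_1_over_n)
  have "?C \<longlonglongrightarrow> (1 - 0) * (1 - 2 * 0) / 6"
    \<comment> \<open>Writing \<open>2 / real n\<close> as a product with an inverse exposes the
      \<open>2 * 0\<close> of the stated limit.\<close>
    unfolding divide_inverse[of 2] by (intro tendsto_intros inv[unfolded divide_inverse mult_1]) auto
  then have C: "?C \<longlonglongrightarrow> 1 / 6"
    by simp
  \<comment> \<open>The lower bound on the turns of the extremal word, divided by
    \<open>n ^ 3\<close>.\<close>
  let ?L = "\<lambda>n. x n * y n * (2 * y n + 2 * x n - 1 / real n) +
    y n * (y n - 1 / real n) * (2 * y n - 1 / real n) / 6"
  have "?L \<longlonglongrightarrow> (s - 1) / 2 * (1 - s / 2) * (2 * (1 - s / 2) + 2 * ((s - 1) / 2) - 0) +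
      (1 - s / 2) * ((1 - s / 2) - 0) * (2 * (1 - s / 2) - 0) / 6"
    by (intro tendsto_intros x y inv) auto
  \<comment> \<open>At the optimal fractions the construction reaches the constant of
    \<open>num_turns_le\<close>.\<close>
  also have "(s - 1) / 2 * (1 - s / 2) * (2 * (1 - s / 2) + 2 * ((s - 1) / 2) - 0) +
      (1 - s / 2) * ((1 - s / 2) - 0) * (2 * (1 - s / 2) - 0) / 6 = (s - 1) / 6"
    by (simp add: field_simps s(1) ss)
  finally have L: "?L \<longlonglongrightarrow> (s - 1) / 6" .
  have choose: "real (n choose 3) = real n ^ 3 * ?C n" if "n \<ge> 3" for n
    using that by (simp add: real_choose_3 field_simps power3_eq_cube)
  have lim: "1 - (s - 1) / 6 / (1 / 6) = 2 - sqrt 2"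
    by (simp add: s_def field_simps)
  show ?thesis
  proof (rule tendsto_sandwich)
    have "(\<lambda>n. 1 - (s - 1) / 6 / ?C n) \<longlonglongrightarrow> 1 - (s - 1) / 6 / (1 / 6)"
      by (intro tendsto_intros C) auto
    then show "(\<lambda>n. 1 - (s - 1) / 6 / ?C n) \<longlonglongrightarrow> 2 - sqrt 2"
      by (simp only: lim)
    have "(\<lambda>n. 1 - ?L n / ?C n) \<longlonglongrightarrow> 1 - (s - 1) / 6 / (1 / 6)"
      by (intro tendsto_diff tendsto_const tendsto_divide L C) auto
    then show "(\<lambda>n. 1 - ?L n / ?C n) \<longlonglongrightarrow> 2 - sqrt 2"
      by (simp only: lim)
    show "\<forall>\<^sub>F n in sequentially. 1 - (s - 1) / 6 / ?C n \<le> min_density 3 3 n"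
      using eventually_ge_at_top[of 3]
    proof eventually_elim
      case (elim n)
      have "(s - 1) / 6 * real n ^ 3 / real (n choose 3) = (s - 1) / 6 / ?C n"
        unfolding choose[OF elim] mult.commute[of _ "real n ^ 3"]
        using elim by (intro mult_divide_mult_cancel_left) simp
      then show ?case
        using min_density_3_3_ge[OF elim] by (simp add: s_def)
    qed
    show "\<forall>\<^sub>F n in sequentially. min_density 3 3 n \<le> 1 - ?L n / ?C n"
      using eventually_ge_at_top[of 3]
    proof eventually_elim
      case (elim n)
      \<comment> \<open>Pulling out \<open>N ^ 3\<close> turns each correction \<open>- 1\<close>
        into \<open>- 1 / N\<close>.\<close>
      have "(X * N) * (Y * N) * (2 * (Y * N) + 2 * (X * N) - 1) +
          (Y * N) * (Y * N - 1) * (2 * (Y * N) - 1) / 6 =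
          N ^ 3 * (X * Y * (2 * Y + 2 * X - 1 / N) + Y * (Y - 1 / N) * (2 * Y - 1 / N) / 6)"
        if "N \<noteq> 0" for N X Y :: real
        using that by (simp add: field_simps power3_eq_cube)
      from this[of "real n" "x n" "y n"]
      have "real (h n) * real (k n) * (2 * real (k n) + 2 * real (h n) - 1) +
          real (k n) * (real (k n) - 1) * (2 * real (k n) - 1) / 6 = real n ^ 3 * ?L n"
        using elim by (simp add: x_def y_def)
      moreover have "real n ^ 3 * ?L n / real (n choose 3) = ?L n / ?C n"
        unfolding choose[OF elim] using elim by (intro mult_divide_mult_cancel_left) simp
      ultimately show ?case
        using min_density_3_3_le[OF elim hk] by (simp only:)
    qed
  qed
qed

theorem theorem1p2:
  shows "convergent (min_density 3 3) \<and> limit_density 3 3 = 2 - sqrt 2"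
  using min_density_3_3_tendsto by (auto simp: limit_density_def convergent_def limI)

end
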